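(* Let $k\in\mathbb N_+$, let $\mathbb V^k$ be either $\mathbb P^k$ or $\mathbb Q^k$, let $a_1,a_2,\Delta x,\Delta y>0$, and let $R=[x_{i-\frac12},x_{i+\frac12}]\times[y_{j-\frac12},y_{j+\frac12}]$ be a rectangle with side lengths $\Delta x=x_{i+\frac12}-x_{i-\frac12}$ and $\Delta y=y_{j+\frac12}-y_{j-\frac12}$. Then there exists a 2D optimal cell average decomposition (OCAD) for $\mathbb V^k$ on $R$, i.e. a feasible CAD maximizing $\mathcal G_2(\omega_1^-,\omega_1^+,\omega_2^-,\omega_2^+)$ among all feasible CADs. Moreover, there exists an OCAD whose boundary weights $(\omega_{1,\star}^-,\omega_{1,\star}^+,\omega_{2,\star}^-,\omega_{2,\star}^+)$ maximize $\mathcal G_2$ and also satisfy $$\frac{\omega_{1,\star}^-\Delta x}{a_1}=\frac{\omega_{1,\star}^+\Delta x}{a_1}=\frac{\omega_{2,\star}^-\Delta y}{a_2}=\frac{\omega_{2,\star}^+\Delta y}{a_2}=\max\mathcal G_2 .$$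
   Context: $\mathbb P^k$: real polynomials in $(x,y)$ of total degree at most $k$; $\mathbb Q^k$: real polynomials in $(x,y)$ of degree at most $k$ in each variable. A 2D feasible CAD for $\mathbb V^k$ on $R$ is an identity $$\frac1{\Delta x\Delta y}\iint_R p\,dx\,dy=\frac1{\Delta y}\int_{y_{j-\frac12}}^{y_{j+\frac12}}\!\!\big(\omega_1^-p(x_{i-\frac12},y)+\omega_1^+p(x_{i+\frac12},y)\big)dy+\frac1{\Delta x}\int_{x_{i-\frac12}}^{x_{i+\frac12}}\!\!\big(\omega_2^-p(x,y_{j-\frac12})+\omega_2^+p(x,y_{j+\frac12})\big)dx+\sum_{s=1}^S\omega_s\,p(x^{(s)},y^{(s)})$$ ($S\ge0$ finite) that holds for all $p\in\mathbb V^k$, with all weights $\omega_1^\pm,\omega_2^\pm,\omega_s$ positive (they sum to one) and all nodes $(x^{(s)},y^{(s)})\in R$. The numbers $\omega_1^\pm,\omega_2^\pm$ are its boundary weights, and $$\mathcal G_2(\omega_1^-,\omega_1^+,\omega_2^-,\omega_2^+)=\min\Big\{\frac{\omega_1^-\Delta x}{a_1},\frac{\omega_1^+\Delta x}{a_1},\frac{\omega_2^-\Delta y}{a_2},\frac{\omega_2^+\Delta y}{a_2}\Big\}.$$ *)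

theory Defs
  imports "HOL-Analysis.Analysis"
begin

text \<open>Over the reals a polynomial is determined by its values, so \<open>\<P>\<^sup>k\<close> and \<open>\<Q>\<^sup>k\<close> are given
  as sets of polynomial functions on the plane.\<close>

definition total_deg_polys :: "nat \<Rightarrow> (real \<times> real \<Rightarrow> real) set" where
  "total_deg_polys k =
     {p. \<exists>c :: nat \<Rightarrow> nat \<Rightarrow> real.
         \<forall>x y. p (x, y) = (\<Sum>(m, n) \<in> {(m, n). m + n \<le> k}. c m n * x ^ m * y ^ n)}"

definition partial_deg_polys :: "nat \<Rightarrow> (real \<times> real \<Rightarrow> real) set" where
  "partial_deg_polys k =
     {p. \<exists>c :: nat \<Rightarrow> nat \<Rightarrow> real.
         \<forall>x y. p (x, y) = (\<Sum>(m, n) \<in> {..k} \<times> {..k}. c m n * x ^ m * y ^ n)}"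

text \<open>The data of a decomposition: boundary weights \<open>\<omega>\<^sub>1\<^sup>-, \<omega>\<^sub>1\<^sup>+, \<omega>\<^sub>2\<^sup>-, \<omega>\<^sub>2\<^sup>+\<close>, the number \<open>S\<close> of
  internal nodes, and their weights and positions. Only the values of \<open>int_weight\<close> and
  \<open>int_node\<close> on \<open>{1..S}\<close> are meaningful.\<close>

record cad =
  w1m :: real
  w1p :: real
  w2m :: real
  w2p :: real
  num_nodes :: nat
  int_weight :: "nat \<Rightarrow> real"
  int_node :: "nat \<Rightarrow> real \<times> real"

text \<open>Here \<open>[xl, xr] \<times> [yl, yr]\<close> is the cell. That the weights sum to one is not demanded
  separately: it is the identity for the constant polynomial 1 (see \<open>weights_sum_to_one\<close>).\<close>

definition feasible_cad ::
  "(real \<times> real \<Rightarrow> real) set \<Rightarrow> real \<Rightarrow> real \<Rightarrow> real \<Rightarrow> real \<Rightarrow> cad \<Rightarrow> bool" where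
  "feasible_cad V xl xr yl yr C \<longleftrightarrow>
     w1m C > 0 \<and> w1p C > 0 \<and> w2m C > 0 \<and> w2p C > 0 \<and>
     (\<forall>s \<in> {1..num_nodes C}. int_weight C s > 0 \<and> int_node C s \<in> {xl..xr} \<times> {yl..yr}) \<and>
     (\<forall>p \<in> V.
        1 / ((xr - xl) * (yr - yl)) * integral ({xl..xr} \<times> {yl..yr}) p =
          1 / (yr - yl) * integral {yl..yr} (\<lambda>y. w1m C * p (xl, y) + w1p C * p (xr, y))
        + 1 / (xr - xl) * integral {xl..xr} (\<lambda>x. w2m C * p (x, yl) + w2p C * p (x, yr))
        + (\<Sum>s = 1..num_nodes C. int_weight C s * p (int_node C s)))"

definition G2 :: "real \<Rightarrow> real \<Rightarrow> real \<Rightarrow> real \<Rightarrow> real \<Rightarrow> real \<Rightarrow> real \<Rightarrow> real \<Rightarrow> real" where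
  "G2 a1 a2 dx dy \<omega>1m \<omega>1p \<omega>2m \<omega>2p =
     Min {\<omega>1m * dx / a1, \<omega>1p * dx / a1, \<omega>2m * dy / a2, \<omega>2p * dy / a2}"

definition cad_G2 :: "real \<Rightarrow> real \<Rightarrow> real \<Rightarrow> real \<Rightarrow> real \<Rightarrow> real \<Rightarrow> cad \<Rightarrow> real" where
  "cad_G2 a1 a2 xl xr yl yr C =
     G2 a1 a2 (xr - xl) (yr - yl) (w1m C) (w1p C) (w2m C) (w2p C)"

definition optimal_cad ::
  "(real \<times> real \<Rightarrow> real) set \<Rightarrow> real \<Rightarrow> real \<Rightarrow> real \<Rightarrow> real \<Rightarrow> real \<Rightarrow> real \<Rightarrow> cad \<Rightarrow> bool" where
  "optimal_cad V a1 a2 xl xr yl yr C \<longleftrightarrow>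
     feasible_cad V xl xr yl yr C \<and>
     (\<forall>C'. feasible_cad V xl xr yl yr C' \<longrightarrow>
        cad_G2 a1 a2 xl xr yl yr C' \<le> cad_G2 a1 a2 xl xr yl yr C)"

text \<open>\<open>GREATEST\<close> denotes the maximum only if it is attained, as it is when an optimal
  decomposition exists.\<close>

definition max_G2 ::
  "(real \<times> real \<Rightarrow> real) set \<Rightarrow> real \<Rightarrow> real \<Rightarrow> real \<Rightarrow> real \<Rightarrow> real \<Rightarrow> real \<Rightarrow> real" where
  "max_G2 V a1 a2 xl xr yl yr =
     (GREATEST g. \<exists>C. feasible_cad V xl xr yl yr C \<and> g = cad_G2 a1 a2 xl xr yl yr C)"

lemma one_in_total_deg_polys: "(\<lambda>_. 1) \<in> total_deg_polys k"
proof -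
  have fin: "finite {(m, n). m + n \<le> k}"
    by (rule finite_subset[of _ "{..k} \<times> {..k}"]) auto
  have "(\<Sum>(m, n) \<in> {(m, n). m + n \<le> k}. (if m = 0 \<and> n = 0 then 1 else 0) * x ^ m * y ^ n)
        = (\<Sum>z \<in> {(m, n). m + n \<le> k}. if z = (0, 0) then 1 else 0)" for x y :: real
    by (rule sum.cong) (auto split: if_splits)
  also have "\<dots> = (1 :: real)" for x y :: real
    using fin by (subst sum.delta) auto
  finally show ?thesis
    unfolding total_deg_polys_def
    by (intro CollectI exI[of _ "\<lambda>m n. if m = 0 \<and> n = 0 then 1 else 0"]) simp
qed

lemma total_deg_subset_partial_deg: "total_deg_polys k \<subseteq> partial_deg_polys k"
proof
  fix p assume "p \<in> total_deg_polys k"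
  then obtain c where c:
    "\<And>x y. p (x, y) = (\<Sum>(m, n) \<in> {(m, n). m + n \<le> k}. c m n * x ^ m * y ^ n)"
    unfolding total_deg_polys_def by blast
  have "p (x, y) = (\<Sum>(m, n) \<in> {..k} \<times> {..k}. (if m + n \<le> k then c m n else 0) * x ^ m * y ^ n)"
    for x y
    unfolding c by (rule sum.mono_neutral_cong_left) (auto split: if_splits)
  then show "p \<in> partial_deg_polys k"
    unfolding partial_deg_polys_def
    by (intro CollectI exI[of _ "\<lambda>m n. if m + n \<le> k then c m n else 0"]) blast
qed

lemma weights_sum_to_one:
  assumes "feasible_cad V xl xr yl yr C" "(\<lambda>_. 1) \<in> V" "xl < xr" "yl < yr"
  shows "w1m C + w1p C + w2m C + w2p C + (\<Sum>s = 1..num_nodes C. int_weight C s) = 1"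
proof -
  have "integral (cbox (xl, yl) (xr, yr)) (\<lambda>_. 1 :: real) = (xr - xl) * (yr - yl)"
    using assms(3,4) by (simp add: content_Pair)
  then have I: "integral ({xl..xr} \<times> {yl..yr}) (\<lambda>_. 1 :: real) = (xr - xl) * (yr - yl)"
    by (metis cbox_Pair_eq cbox_interval)
  have "1 / ((xr - xl) * (yr - yl)) * integral ({xl..xr} \<times> {yl..yr}) (\<lambda>_. 1 :: real) =
          1 / (yr - yl) * integral {yl..yr} (\<lambda>y. w1m C * 1 + w1p C * 1)
        + 1 / (xr - xl) * integral {xl..xr} (\<lambda>x. w2m C * 1 + w2p C * 1)
        + (\<Sum>s = 1..num_nodes C. int_weight C s * 1)"
    using assms(1,2) unfolding feasible_cad_def by blast
  then show ?thesis
    using assms(3,4) by (simp add: I)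
qed

end

theory Submission
  imports Defs
begin

text \<open>Edge averages are positive combinations of point evaluations, by a positive quadrature rule on
  an interval. So lowering each boundary weight of a feasible decomposition with
  \<open>\<G>\<^sub>2 = t\<close> to \<open>t a\<^sub>1/\<Delta>x\<close> respectively \<open>t a\<^sub>2/\<Delta>y\<close> and turning the excess into internal nodes leaves a
  feasible decomposition with \<open>\<G>\<^sub>2 = t\<close>. It remains to maximise \<open>t\<close> such that the cell average minus
  \<open>t\<close> times the fixed combination of edge averages is a nonnegative combination of point
  evaluations. By Caratheodory's theorem the number of nodes can be bounded, so the maximum is
  attained by compactness. It is positive because a quadrature rule that gives positive weight to the
  end points of the interval, applied in \<open>x\<close> or in \<open>y\<close>, splits positive multiples of the edge averages
  off the cell average.\<close>

section \<open>Positive quadrature on an interval\<close>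

text \<open>The error on \<open>{a..t}\<close>, seen as a function \<open>g\<close> of the right end
  point, vanishes at \<open>a\<close>, and its derivative is half a first-order Taylor remainder. So
  the mean value inequality gives cubic order. The constant is not sharp; only the order matters
  later.\<close>

lemma trapezoid_error:
  fixes f f' f'' :: "real \<Rightarrow> real"
  assumes "a \<le> b"
    and f: "\<And>x. x \<in> {a..b} \<Longrightarrow> (f has_real_derivative f' x) (at x within {a..b})"
    and f': "\<And>x. x \<in> {a..b} \<Longrightarrow> (f' has_real_derivative f'' x) (at x within {a..b})"
    and M: "\<And>x. x \<in> {a..b} \<Longrightarrow> \<bar>f'' x\<bar> \<le> M"
  shows "\<bar>integral {a..b} f - (b - a) / 2 * (f a + f b)\<bar> \<le> M * (b - a) ^ 3"
proof -
  have lip: "\<bar>f' x - f' y\<bar> \<le> M * (b - a)" if "x \<in> {a..b}" "y \<in> {a..b}" for x y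
  proof -
    have "norm (f' x - f' y) \<le> M * norm (x - y)"
      using that f' M by (intro field_differentiable_bound[of "{a..b}" f' f'' M x y]) auto
    also have "\<dots> \<le> M * (b - a)"
      using that M[of x] by (intro mult_left_mono) auto
    finally show ?thesis by simp
  qed
  define g where "g t = integral {a..t} f - (t - a) / 2 * (f a + f t)" for t
  define g' where "g' t = f t - ((f a + f t) / 2 + (t - a) / 2 * f' t)" for t
  have cont: "continuous_on {a..b} f"
    using f DERIV_continuous_on by blast
  have g: "(g has_real_derivative g' t) (at t within {a..b})" if t: "t \<in> {a..b}" for t
    unfolding g_def[abs_def] g'_def
    by (auto intro!: derivative_eq_intros integral_has_real_derivative[OF cont t] f[OF t]
        simp: field_simps)
  have g'_bound: "norm (g' t) \<le> M * (b - a) ^ 2" if t: "t \<in> {a..b}" for t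
  proof -
    \<comment> \<open>The mean value inequality for \<open>f\<close> minus its linear part at
      \<open>t\<close>: the derivative \<open>f' s - f' t\<close> is small because \<open>f'\<close>
      is Lipschitz with constant \<open>M\<close>.\<close>
    have "norm ((f t - f' t * t) - (f a - f' t * a)) \<le> (M * (b - a)) * norm (t - a)"
    proof (rule field_differentiable_bound[of "{a..b}" "\<lambda>s. f s - f' t * s" "\<lambda>s. f' s - f' t"])
      fix s assume s: "s \<in> {a..b}"
      show "((\<lambda>s. f s - f' t * s) has_real_derivative f' s - f' t) (at s within {a..b})"
        by (rule derivative_eq_intros f[OF s] refl)+ simp
      show "norm (f' s - f' t) \<le> M * (b - a)"
        using lip[OF s t] by simp
    qed (use t in auto)
    also have "\<dots> \<le> (M * (b - a)) * (b - a)"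
      using t M[OF t] by (intro mult_left_mono) auto
    finally have "\<bar>f t - f a - f' t * (t - a)\<bar> \<le> M * (b - a) ^ 2"
      by (simp add: algebra_simps power2_eq_square)
    moreover have "g' t = (f t - f a - f' t * (t - a)) / 2"
      unfolding g'_def by (simp add: field_simps)
    ultimately show ?thesis by simp
  qed
  have "norm (g b - g a) \<le> M * (b - a) ^ 2 * norm (b - a)"
    by (rule field_differentiable_bound[of "{a..b}" g g']) (use g g'_bound \<open>a \<le> b\<close> in auto)
  then show ?thesis
    using \<open>a \<le> b\<close> by (simp add: g_def power3_eq_cube power2_eq_square mult.assoc)
qed

text \<open>Induction on the number of panels. The \<open>of_bool\<close> factors count the panels
  to the left and right of a grid point, so a new panel adds \<open>h / 2\<close> at both of its
  ends. For fixed \<open>h * real n\<close> the bound is of order \<open>h\<close> squared.\<close>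

lemma composite_trapezoid_error:
  fixes p :: "real poly"
  assumes h: "h \<ge> 0"
    and M: "\<And>x. x \<in> {a..a + h * real n} \<Longrightarrow> \<bar>poly (pderiv (pderiv p)) x\<bar> \<le> M"
  shows "\<bar>integral {a..a + h * real n} (poly p)
     - (\<Sum>i\<le>n. h / 2 * (of_bool (i < n) + of_bool (i > 0)) * poly p (a + h * real i))\<bar> \<le> real n * (M * h ^ 3)"
  using M
proof (induction n)
  case 0
  then show ?case by simp
next
  case (Suc n)
  let ?T = "\<lambda>n. \<Sum>i\<le>n. h / 2 * (of_bool (i < n) + of_bool (i > 0)) * poly p (a + h * real i)"
  have sub: "{a..a + h * real n} \<subseteq> {a..a + h * real (Suc n)}"
    using h by (auto simp: algebra_simps)
  have IH: "\<bar>integral {a..a + h * real n} (poly p) - ?T n\<bar> \<le> real n * (M * h ^ 3)"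
    using Suc.IH Suc.prems sub by blast
  have "integral {a..a + h * real (Suc n)} (poly p)
     = integral {a..a + h * real n} (poly p) + integral {a + h * real n..a + h * real (Suc n)} (poly p)"
    using h by (intro Henstock_Kurzweil_Integration.integral_combine[symmetric] integrable_continuous_real)
       (auto simp: algebra_simps intro!: continuous_intros)
  moreover have "?T (Suc n) = ?T n + h / 2 * (poly p (a + h * real n) + poly p (a + h * real (Suc n)))"
    by (cases n) (simp_all add: algebra_simps)
  moreover have "\<bar>integral {a + h * real n..a + h * real (Suc n)} (poly p)
      - (a + h * real (Suc n) - (a + h * real n)) / 2 * (poly p (a + h * real n) + poly p (a + h * real (Suc n)))\<bar>
      \<le> M * (a + h * real (Suc n) - (a + h * real n)) ^ 3"
  proof (rule trapezoid_error)
    fix x assume "x \<in> {a + h * real n..a + h * real (Suc n)}"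
    moreover have "0 \<le> h * real n" using h by simp
    ultimately have "x \<in> {a..a + h * real (Suc n)}" by auto
    then show "\<bar>poly (pderiv (pderiv p)) x\<bar> \<le> M" by (rule Suc.prems)
  qed (use h in \<open>auto simp: algebra_simps intro: poly_DERIV has_field_derivative_at_within\<close>)
  ultimately show ?case
    using IH by (simp add: algebra_simps)
qed

text \<open>Both sides have degree less than \<open>card X\<close> and agree on \<open>X\<close>.
  This form turns a linear functional on such polynomials into a combination of evaluations at
  \<open>X\<close>.\<close>

lemma lagrange_basis:
  fixes X :: "real set"
  assumes X: "finite X"
  obtains l :: "real \<Rightarrow> real poly" where
    "\<And>q. degree q < card X \<Longrightarrow> q = (\<Sum>x\<in>X. smult (poly q x) (l x))"
proof
  define l where "l x = smult (inverse (\<Prod>y\<in>X - {x}. x - y)) (\<Prod>y\<in>X - {x}. [:- y, 1:])" for x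
  have l: "poly (l x) y = of_bool (x = y)" if "x \<in> X" "y \<in> X" for x y
  proof (cases "x = y")
    case True
    moreover have "(\<Prod>y\<in>X - {x}. x - y) \<noteq> 0" using X by auto
    ultimately show ?thesis using that by (simp add: l_def poly_prod)
  next
    case False
    then have "(\<Prod>z\<in>X - {x}. y - z) = 0"
      using that X by (intro prod_zero) auto
    then show ?thesis using False by (simp add: l_def poly_prod)
  qed
  fix q :: "real poly" assume q: "degree q < card X"
  have deg: "degree (l x) < card X" if "x \<in> X" for x
  proof -
    have "degree (l x) \<le> degree (\<Prod>y\<in>X - {x}. [:- y, 1:])"
      unfolding l_def by (rule degree_smult_le)
    also have "\<dots> \<le> (\<Sum>y\<in>X - {x}. degree [:- y, 1:])"
      using X degree_prod_sum_le[of "X - {x}" "\<lambda>y. [:- y, 1:]"] by (simp add: o_def)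
    also have "\<dots> = card X - 1" using X that by simp
    also have "\<dots> < card X" using X that by (metis card_gt_0_iff diff_less empty_iff zero_less_one)
    finally show ?thesis .
  qed
  show "q = (\<Sum>x\<in>X. smult (poly q x) (l x))"
  proof (rule poly_eqI_degree)
    fix y assume "y \<in> X"
    then have "(\<Sum>x\<in>X. poly q x * poly (l x) y) = (\<Sum>x\<in>X. if x = y then poly q x else 0)"
      by (intro sum.cong) (auto simp: l)
    also have "\<dots> = poly q y"
      using X \<open>y \<in> X\<close> by simp
    finally show "poly q y = poly (\<Sum>x\<in>X. smult (poly q x) (l x)) y"
      by (simp add: poly_sum)
  next
    show "degree (\<Sum>x\<in>X. smult (poly q x) (l x)) < card X"
      using q by (intro degree_sum_less) (auto intro: le_less_trans[OF degree_smult_le] deg)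
  qed (use q in auto)
qed

text \<open>The composite trapezoidal rule with step \<open>h\<close> has weights at least \<open>h / 2\<close> and error \<open>O(h\<^sup>2)\<close>. Its
  error functional is a combination of the evaluations at \<open>k + 2\<close> fixed nodes of the grid, with
  coefficients \<open>O(h\<^sup>2)\<close>; for small \<open>h\<close> correcting the weights by them keeps all weights positive.\<close>

lemma positive_quadrature_poly:
  fixes a b :: real
  assumes ab: "a < b"
  obtains n :: nat and w :: "nat \<Rightarrow> real" where "n > 0" "\<And>i. i \<le> n \<Longrightarrow> w i > 0"
    "\<And>q. degree q \<le> k \<Longrightarrow>
       integral {a..b} (poly q) = (\<Sum>i\<le>n. w i * poly q (a + (b - a) * real i / real n))"
proof -
  \<comment> \<open>The correction nodes do not depend on the step, so neither does the bound
    \<open>M\<close> on the second derivatives of their Lagrange basis.\<close>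
  define \<xi> where "\<xi> j = a + (b - a) * real j / real (Suc k)" for j
  define X where "X = \<xi> ` {..Suc k}"
  have inj: "inj_on \<xi> A" for A
    using ab by (auto simp: inj_on_def \<xi>_def)
  have cardX: "card X = Suc (Suc k)"
    unfolding X_def by (simp add: card_image inj)
  obtain l where l: "\<And>q. degree q < card X \<Longrightarrow> q = (\<Sum>x\<in>X. smult (poly q x) (l x))"
    using lagrange_basis[of X] by (auto simp: X_def)
  have "\<exists>B. \<forall>x\<in>{a..b}. \<bar>poly (pderiv (pderiv (l y))) x\<bar> \<le> B" for y
  proof -
    have "bounded (poly (pderiv (pderiv (l y))) ` {a..b})"
      by (intro compact_imp_bounded compact_continuous_image continuous_intros) auto
    then show ?thesis
      by (auto simp: bounded_iff)
  qed
  then obtain B where B: "\<And>y x. x \<in> {a..b} \<Longrightarrow> \<bar>poly (pderiv (pderiv (l y))) x\<bar> \<le> B y"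
    by metis
  define M where "M = Max (B ` X)"
  have M: "\<bar>poly (pderiv (pderiv (l y))) x\<bar> \<le> M" if "x \<in> {a..b}" "y \<in> X" for x y
  proof -
    have "B y \<le> M" unfolding M_def using that by (auto simp: X_def)
    then show ?thesis using B[OF that(1), of y] by linarith
  qed
  \<comment> \<open>Chosen so that the error bound, which equals \<open>2 * M * (b - a) ^ 2\<close>
    times \<open>h / (2 * real n)\<close>, falls below \<open>h / 2\<close>.\<close>
  obtain m :: nat where m: "2 * M * (b - a) ^ 2 < real m"
    using reals_Archimedean2 by blast
  have "a \<in> {a..b}" "\<xi> 0 \<in> X" using ab by (auto simp: X_def)
  from M[OF this] have "0 \<le> M" by linarith
  then have "m > 0" using m by (metis mult_nonneg_nonneg not_gr_zero of_nat_0 not_le zero_le_numeral zero_le_power2)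
  \<comment> \<open>A multiple of \<open>Suc k\<close>, so that \<open>\<xi> j\<close> is the grid
    point with index \<open>j * m\<close> and the correction needs no new nodes.\<close>
  define n where "n = Suc k * m"
  define h where "h = (b - a) / real n"
  have n: "n > 0" "m \<le> n" using \<open>m > 0\<close> by (auto simp: n_def)
  have h: "h > 0" "h * real n = b - a" using n ab by (auto simp: h_def)
  define T where "T q = (\<Sum>i\<le>n. h / 2 * (of_bool (i < n) + of_bool (i > 0)) * poly q (a + h * real i))" for q
  define e where "e x = integral {a..b} (poly (l x)) - T (l x)" for x
  have e: "\<bar>e x\<bar> < h / 2" if "x \<in> X" for x
  proof -
    have "\<bar>e x\<bar> \<le> real n * (M * h ^ 3)"
      using composite_trapezoid_error[of h a n "l x" M] h M that by (simp add: e_def T_def)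
    also have "\<dots> = M * (b - a) * h ^ 2"
      using h(2)[symmetric] by (simp add: power2_eq_square power3_eq_cube)
    also have "\<dots> = (2 * M * (b - a) ^ 2) * (h / (2 * real n))"
      using n by (simp add: h_def power2_eq_square)
    also have "\<dots> < real n * (h / (2 * real n))"
      using m n h by (intro mult_strict_right_mono) auto
    also have "\<dots> = h / 2" using n by simp
    finally show ?thesis .
  qed
  \<comment> \<open>The indices divisible by \<open>m\<close> are those of the correction nodes, and
    \<open>i div m\<close> recovers the number of the node.\<close>
  define w where "w i = h / 2 * (of_bool (i < n) + of_bool (i > 0))
      + (if m dvd i then e (\<xi> (i div m)) else 0)" for i
  show thesis
  proof
    show "n > 0" by fact
    show "w i > 0" if "i \<le> n" for i
    proof -
      have "h / 2 \<le> h / 2 * (of_bool (i < n) + of_bool (i > 0))"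
        using that n h by (auto simp: of_bool_def)
      moreover have "\<bar>e (\<xi> (i div m))\<bar> < h / 2"
      proof (rule e)
        have "i div m \<le> Suc k"
          using div_le_mono[OF that, of m] \<open>m > 0\<close> unfolding n_def by simp
        then show "\<xi> (i div m) \<in> X" by (auto simp: X_def)
      qed
      ultimately show ?thesis
        using h unfolding w_def by (auto split: if_splits)
    qed
  next
    fix q :: "real poly" assume q: "degree q \<le> k"
    have eq: "q = (\<Sum>x\<in>X. smult (poly q x) (l x))"
      using q cardX by (intro l) auto
    have corr: "(\<Sum>i\<le>n. (if m dvd i then e (\<xi> (i div m)) else 0) * poly q (a + h * real i)) = (\<Sum>x\<in>X. e x * poly q x)"
    proof -
      have img: "(\<lambda>j. j * m) ` {..Suc k} = {i \<in> {..n}. m dvd i}"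
        using \<open>m > 0\<close> by (auto simp: n_def dvd_def image_iff mult.commute[of m] simp del: mult_Suc)
      have "(\<Sum>i\<le>n. (if m dvd i then e (\<xi> (i div m)) else 0) * poly q (a + h * real i))
          = (\<Sum>i\<in>{i \<in> {..n}. m dvd i}. e (\<xi> (i div m)) * poly q (a + h * real i))"
        by (rule sum.mono_neutral_cong_right) auto
      also have "\<dots> = (\<Sum>j\<le>Suc k. e (\<xi> j) * poly q (a + h * real (j * m)))"
        unfolding img[symmetric] using \<open>m > 0\<close>
        by (subst sum.reindex) (auto simp: inj_on_def)
      also have "\<dots> = (\<Sum>j\<le>Suc k. e (\<xi> j) * poly q (\<xi> j))"
      proof (intro sum.cong refl)
        fix j
        have "a + h * real (j * m) = \<xi> j"
          using \<open>m > 0\<close> unfolding \<xi>_def h_def n_def by (simp del: of_nat_Suc mult_Suc)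
        then show "e (\<xi> j) * poly q (a + h * real (j * m)) = e (\<xi> j) * poly q (\<xi> j)" by simp
      qed
      also have "\<dots> = (\<Sum>x\<in>X. e x * poly q x)"
        unfolding X_def by (subst sum.reindex[OF inj]) simp
      finally show ?thesis .
    qed
    have "poly q = (\<lambda>t. \<Sum>x\<in>X. poly q x * poly (l x) t)"
    proof
      fix t
      show "poly q t = (\<Sum>x\<in>X. poly q x * poly (l x) t)"
        using arg_cong[OF eq, of "\<lambda>q. poly q t"] by (simp add: poly_sum)
    qed
    then have "integral {a..b} (poly q) = integral {a..b} (\<lambda>t. \<Sum>x\<in>X. poly q x * poly (l x) t)"
      by (rule arg_cong)
    also have "\<dots> = (\<Sum>x\<in>X. poly q x * integral {a..b} (poly (l x)))"
      by (subst integral_sum)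
         (auto simp: X_def intro!: integrable_continuous_real continuous_intros)
    also have "\<dots> = (\<Sum>x\<in>X. poly q x * T (l x)) + (\<Sum>x\<in>X. e x * poly q x)"
      by (simp add: e_def algebra_simps flip: sum.distrib)
    also have "(\<Sum>x\<in>X. poly q x * T (l x)) = T q"
    proof -
      have "T q = T (\<Sum>x\<in>X. smult (poly q x) (l x))"
        using eq by simp
      also have "\<dots> = (\<Sum>x\<in>X. poly q x * T (l x))"
        unfolding T_def poly_sum sum_distrib_left
        by (subst sum.swap) (simp add: mult_ac)
      finally show ?thesis ..
    qed
    also have "T q + (\<Sum>x\<in>X. e x * poly q x) = (\<Sum>i\<le>n. w i * poly q (a + h * real i))"
      unfolding corr[symmetric] T_def w_def by (simp only: distrib_right sum.distrib)
    finally show "integral {a..b} (poly q) = (\<Sum>i\<le>n. w i * poly q (a + (b - a) * real i / real n))"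
      by (simp add: h_def)
  qed
qed

text \<open>The form that fits restrictions of bivariate polynomials to lines. Nodes and weights are
  fixed before \<open>f\<close>, so one rule serves all parallel lines.\<close>

lemma positive_quadrature:
  fixes a b :: real
  assumes "a < b"
  obtains n :: nat and w :: "nat \<Rightarrow> real" where "n > 0" "\<And>i. i \<le> n \<Longrightarrow> w i > 0"
    "\<And>f. \<exists>c. \<forall>x. f x = (\<Sum>m\<le>k. c m * x ^ m) \<Longrightarrow>
       integral {a..b} f = (\<Sum>i\<le>n. w i * f (a + (b - a) * real i / real n))"
proof -
  obtain n w where nw: "n > 0" "\<And>i. i \<le> n \<Longrightarrow> w i > 0"
    "\<And>q. degree q \<le> k \<Longrightarrow>
       integral {a..b} (poly q) = (\<Sum>i\<le>n. w i * poly q (a + (b - a) * real i / real n))"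
    using positive_quadrature_poly[OF assms, of k] by blast
  show thesis
  proof (rule that[OF nw(1,2)])
    fix f :: "real \<Rightarrow> real" assume "\<exists>c. \<forall>x. f x = (\<Sum>m\<le>k. c m * x ^ m)"
    then obtain c where c: "\<And>x. f x = (\<Sum>m\<le>k. c m * x ^ m)" by blast
    have "f = poly (\<Sum>m\<le>k. monom (c m) m)"
      by (rule ext) (simp add: c poly_sum poly_monom)
    moreover have "degree (\<Sum>m\<le>k. monom (c m) m) \<le> k"
      by (intro degree_sum_le) (auto intro: order.trans[OF degree_monom_le])
    ultimately show "integral {a..b} f = (\<Sum>i\<le>n. w i * f (a + (b - a) * real i / real n))"
      using nw(3) by simp
  qed
qed

section \<open>Conic combinations of point evaluations\<close>

text \<open>The functionals that coincide on \<open>V\<close> with a finite nonnegative combination of evaluations at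
  points of \<open>R\<close>; their values outside \<open>V\<close> are irrelevant.\<close>

definition point_cone :: "('a \<Rightarrow> real) set \<Rightarrow> 'a set \<Rightarrow> (('a \<Rightarrow> real) \<Rightarrow> real) set" where
  "point_cone V R = {\<Lambda>. \<exists>Z w. finite Z \<and> Z \<subseteq> R \<and> (\<forall>z\<in>Z. 0 \<le> w z) \<and>
     (\<forall>p\<in>V. \<Lambda> p = (\<Sum>z\<in>Z. w z * p z))}"

lemma point_cone_cong:
  assumes "\<Lambda> \<in> point_cone V R" "\<And>p. p \<in> V \<Longrightarrow> \<Lambda>' p = \<Lambda> p"
  shows "\<Lambda>' \<in> point_cone V R"
  using assms unfolding point_cone_def by simp

lemma point_cone_zero: "(\<lambda>p. 0) \<in> point_cone V R"
  unfolding point_cone_def by (intro CollectI exI[of _ "{}"]) auto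

lemma point_cone_eval:
  assumes "z \<in> R"
  shows "(\<lambda>p. p z) \<in> point_cone V R"
  unfolding point_cone_def using assms
  by (intro CollectI exI[of _ "{z}"] exI[of _ "\<lambda>_. 1"]) auto

lemma point_cone_scale:
  assumes "\<Lambda> \<in> point_cone V R" "0 \<le> c"
  shows "(\<lambda>p. c * \<Lambda> p) \<in> point_cone V R"
proof -
  obtain Z w where "finite Z" "Z \<subseteq> R" "\<forall>z\<in>Z. 0 \<le> w z" "\<forall>p\<in>V. \<Lambda> p = (\<Sum>z\<in>Z. w z * p z)"
    using assms unfolding point_cone_def by blast
  then show ?thesis
    unfolding point_cone_def using \<open>0 \<le> c\<close>
    by (intro CollectI exI[of _ Z] exI[of _ "\<lambda>z. c * w z"]) (auto simp: sum_distrib_left mult.assoc)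
qed

lemma point_cone_add:
  assumes "\<Lambda>1 \<in> point_cone V R" "\<Lambda>2 \<in> point_cone V R"
  shows "(\<lambda>p. \<Lambda>1 p + \<Lambda>2 p) \<in> point_cone V R"
proof -
  obtain Z1 w1 where 1: "finite Z1" "Z1 \<subseteq> R" "\<forall>z\<in>Z1. 0 \<le> w1 z" "\<forall>p\<in>V. \<Lambda>1 p = (\<Sum>z\<in>Z1. w1 z * p z)"
    using assms(1) unfolding point_cone_def by blast
  obtain Z2 w2 where 2: "finite Z2" "Z2 \<subseteq> R" "\<forall>z\<in>Z2. 0 \<le> w2 z" "\<forall>p\<in>V. \<Lambda>2 p = (\<Sum>z\<in>Z2. w2 z * p z)"
    using assms(2) unfolding point_cone_def by blast
  define w where "w z = of_bool (z \<in> Z1) * w1 z + of_bool (z \<in> Z2) * w2 z" for z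
  have "(\<Sum>z\<in>Z1 \<union> Z2. w z * p z) = (\<Sum>z\<in>Z1. w1 z * p z) + (\<Sum>z\<in>Z2. w2 z * p z)" for p
  proof -
    have "(\<Sum>z\<in>Z1 \<union> Z2. w z * p z)
        = (\<Sum>z\<in>Z1 \<union> Z2. of_bool (z \<in> Z1) * w1 z * p z) + (\<Sum>z\<in>Z1 \<union> Z2. of_bool (z \<in> Z2) * w2 z * p z)"
      by (simp only: w_def distrib_right sum.distrib)
    also have "(\<Sum>z\<in>Z1 \<union> Z2. of_bool (z \<in> Z1) * w1 z * p z) = (\<Sum>z\<in>Z1. w1 z * p z)"
      using 1 2 by (intro sum.mono_neutral_cong_right) auto
    also have "(\<Sum>z\<in>Z1 \<union> Z2. of_bool (z \<in> Z2) * w2 z * p z) = (\<Sum>z\<in>Z2. w2 z * p z)"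
      using 1 2 by (intro sum.mono_neutral_cong_right) auto
    finally show ?thesis .
  qed
  then show ?thesis
    unfolding point_cone_def using 1 2
    by (intro CollectI exI[of _ "Z1 \<union> Z2"] exI[of _ w]) (auto simp: w_def)
qed

lemma point_cone_sum:
  assumes "\<And>i. i \<in> I \<Longrightarrow> \<Lambda> i \<in> point_cone V R"
  shows "(\<lambda>p. \<Sum>i\<in>I. \<Lambda> i p) \<in> point_cone V R"
  using assms
  by (induction I rule: infinite_finite_induct) (auto intro: point_cone_zero point_cone_add)

lemma point_cone_compose:
  assumes "\<Lambda> \<in> point_cone ((\<lambda>p. p \<circ> h) ` V) R"
  shows "(\<lambda>p. \<Lambda> (p \<circ> h)) \<in> point_cone V (h ` R)"
proof -
  obtain Z w where Z: "finite Z" "Z \<subseteq> R" "\<forall>z\<in>Z. 0 \<le> w z"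
    "\<forall>p\<in>V. \<Lambda> (p \<circ> h) = (\<Sum>z\<in>Z. w z * p (h z))"
    using assms unfolding point_cone_def by auto
  have "(\<lambda>p. \<Sum>z\<in>Z. w z * p (h z)) \<in> point_cone V (h ` R)"
    using Z by (intro point_cone_sum point_cone_scale point_cone_eval) auto
  then show ?thesis
    by (rule point_cone_cong) (use Z in auto)
qed

section \<open>Caratheodory's theorem for cones\<close>

text \<open>A homogeneous linear system with more unknowns than equations, solved by Gaussian
  elimination: equation \<open>j\<close> removes one unknown \<open>z0\<close>.\<close>

lemma nontrivial_linear_dependence:
  fixes f :: "'j \<Rightarrow> 'a \<Rightarrow> real"
  assumes "finite J" "finite Z" "card J < card Z"
  obtains u z where "z \<in> Z" "u z \<noteq> 0" "\<And>j. j \<in> J \<Longrightarrow> (\<Sum>z\<in>Z. u z * f j z) = 0"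
proof -
  have "\<exists>u. (\<exists>z\<in>Z. u z \<noteq> 0) \<and> (\<forall>j\<in>J. (\<Sum>z\<in>Z. u z * f j z) = 0)"
    using assms
  proof (induction J arbitrary: Z f rule: finite_induct)
    case empty
    then show ?case by (intro exI[of _ "\<lambda>_. 1"]) (auto simp: card_gt_0_iff)
  next
    case (insert j J)
    show ?case
    proof (cases "\<forall>z\<in>Z. f j z = 0")
      case True
      then show ?thesis using insert.IH[of Z f] insert.prems insert.hyps by auto
    next
      case False
      then obtain z0 where z0: "z0 \<in> Z" "f j z0 \<noteq> 0" by blast
      define Z' where "Z' = Z - {z0}"
      have Z': "finite Z'" "card J < card Z'"
        using insert.prems insert.hyps z0 by (auto simp: Z'_def)
      obtain u where u: "\<exists>z\<in>Z'. u z \<noteq> 0"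
        "\<forall>i\<in>J. (\<Sum>z\<in>Z'. u z * (f i z - f j z / f j z0 * f i z0)) = 0"
        using insert.IH[OF Z', of "\<lambda>i z. f i z - f j z / f j z0 * f i z0"] by blast
      \<comment> \<open>Back substitution: the value at \<open>z0\<close> is the one that makes
        equation \<open>j\<close> hold.\<close>
      define v where "v = u(z0 := - (\<Sum>z\<in>Z'. u z * f j z) / f j z0)"
      have "(\<Sum>z\<in>Z. v z * g z) = v z0 * g z0 + (\<Sum>z\<in>Z'. v z * g z)" for g
        unfolding Z'_def using insert.prems z0 by (subst sum.remove[of Z z0]) auto
      moreover have "(\<Sum>z\<in>Z'. v z * g z) = (\<Sum>z\<in>Z'. u z * g z)" for g
        by (intro sum.cong) (auto simp: v_def Z'_def)
      ultimately have split: "(\<Sum>z\<in>Z. v z * g z) = v z0 * g z0 + (\<Sum>z\<in>Z'. u z * g z)" for g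
        by simp
      have "(\<Sum>z\<in>Z. v z * f i z) = 0" if "i \<in> insert j J" for i
      proof (cases "i = j")
        case True
        then show ?thesis using z0 by (simp add: split) (simp add: v_def)
      next
        case False
        then have "0 = (\<Sum>z\<in>Z'. u z * (f i z - f j z / f j z0 * f i z0))" using u that by auto
        also have "\<dots> = (\<Sum>z\<in>Z'. u z * f i z) - (\<Sum>z\<in>Z'. u z * f j z) / f j z0 * f i z0"
          by (simp add: algebra_simps sum_subtractf sum_distrib_left sum_distrib_right sum_divide_distrib)
        finally show ?thesis by (simp add: split) (simp add: v_def)
      qed
      moreover have "\<exists>z\<in>Z. v z \<noteq> 0" using u(1) by (auto simp: v_def Z'_def)
      ultimately show ?thesis by blast
    qed
  qed
  then show thesis using that by blast
qed

text \<open>Points of weight zero are dropped. If more than \<open>card J\<close> points remain,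
  subtracting a multiple of a linear dependence makes some weight vanish while the sums and the
  signs are kept.\<close>

lemma conic_caratheodory:
  fixes f :: "'j \<Rightarrow> 'a \<Rightarrow> real"
  assumes "finite J" "finite Z" "\<forall>z\<in>Z. 0 \<le> w z"
  shows "\<exists>Z' w'. Z' \<subseteq> Z \<and> card Z' \<le> card J \<and> (\<forall>z\<in>Z'. 0 < w' z) \<and>
    (\<forall>j\<in>J. (\<Sum>z\<in>Z'. w' z * f j z) = (\<Sum>z\<in>Z. w z * f j z))"
  using assms(2,3)
proof (induction "card Z" arbitrary: Z w rule: less_induct)
  case less
  consider (zero) z0 where "z0 \<in> Z" "w z0 = 0"
    | (small) "\<forall>z\<in>Z. 0 < w z" "card Z \<le> card J"
    | (large) "\<forall>z\<in>Z. 0 < w z" "card J < card Z"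
    using less.prems by fastforce
  then show ?case
  proof cases
    case zero
    have "card (Z - {z0}) < card Z" using zero less.prems by (meson card_Diff1_less)
    from less.hyps[OF this, of w] less.prems obtain Z' w' where *:
      "Z' \<subseteq> Z - {z0}" "card Z' \<le> card J" "\<forall>z\<in>Z'. 0 < w' z"
      "\<forall>j\<in>J. (\<Sum>z\<in>Z'. w' z * f j z) = (\<Sum>z\<in>Z - {z0}. w z * f j z)" by auto
    have "(\<Sum>z\<in>Z. w z * f j z) = (\<Sum>z\<in>Z - {z0}. w z * f j z)" for j
      using zero less.prems by (subst sum.remove[of Z z0]) auto
    with * show ?thesis by (intro exI[of _ Z'] exI[of _ w']) auto
  next
    case small
    then show ?thesis by blast
  next
    case large
    obtain u0 z1 where u0: "z1 \<in> Z" "u0 z1 \<noteq> 0" "\<And>j. j \<in> J \<Longrightarrow> (\<Sum>z\<in>Z. u0 z * f j z) = 0"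
      using nontrivial_linear_dependence[OF \<open>finite J\<close> less.prems(1) large(2), of f] by metis
    \<comment> \<open>The sign is fixed so that \<open>u\<close> is positive somewhere and the
      minimum below is over a nonempty set.\<close>
    define u where "u z = sgn (u0 z1) * u0 z" for z
    have u: "u z1 > 0" "\<And>j. j \<in> J \<Longrightarrow> (\<Sum>z\<in>Z. u z * f j z) = 0"
      using u0 by (auto simp: u_def mult.assoc sgn_if simp flip: sum_distrib_left)
    define P where "P = {z \<in> Z. u z > 0}"
    have P: "finite P" "P \<noteq> {}" using u u0 less.prems by (auto simp: P_def)
    \<comment> \<open>The largest multiple of \<open>u\<close> that can be subtracted from
      \<open>w\<close> with all weights staying nonnegative; the minimiser loses its weight.\<close>
    define c where "c = Min ((\<lambda>z. w z / u z) ` P)"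
    have "c \<in> (\<lambda>z. w z / u z) ` P" unfolding c_def using P by (intro Min_in) auto
    then obtain z0 where z0: "z0 \<in> P" "c = w z0 / u z0" by blast
    have c: "c * u z \<le> w z" if "z \<in> P" for z
    proof -
      have "c \<le> w z / u z" unfolding c_def using P that by (intro Min_le) auto
      then show ?thesis using that by (simp add: P_def field_simps)
    qed
    have "c \<ge> 0" using z0 large by (auto simp: P_def intro: less_imp_le)
    define w2 where "w2 z = w z - c * u z" for z
    have w2: "0 \<le> w2 z" if "z \<in> Z" for z
    proof (cases "z \<in> P")
      case False
      then have "c * u z \<le> 0" using that \<open>c \<ge> 0\<close> by (auto simp: P_def mult_nonneg_nonpos)
      then show ?thesis using large that by (auto simp: w2_def intro: order.trans less_imp_le)
    qed (use c in \<open>simp add: w2_def\<close>)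
    have z0Z: "z0 \<in> Z" "w2 z0 = 0" using z0 by (auto simp: w2_def P_def)
    have "card (Z - {z0}) < card Z" using z0Z less.prems by (meson card_Diff1_less)
    from less.hyps[OF this, of w2] less.prems w2 obtain Z' w' where *:
      "Z' \<subseteq> Z - {z0}" "card Z' \<le> card J" "\<forall>z\<in>Z'. 0 < w' z"
      "\<forall>j\<in>J. (\<Sum>z\<in>Z'. w' z * f j z) = (\<Sum>z\<in>Z - {z0}. w2 z * f j z)" by auto
    have "(\<Sum>z\<in>Z - {z0}. w2 z * f j z) = (\<Sum>z\<in>Z. w z * f j z)" if "j \<in> J" for j
    proof -
      have "(\<Sum>z\<in>Z - {z0}. w2 z * f j z) = (\<Sum>z\<in>Z. w2 z * f j z)"
        using z0Z less.prems by (subst sum.remove[of Z z0]) auto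
      also have "\<dots> = (\<Sum>z\<in>Z. w z * f j z) - c * (\<Sum>z\<in>Z. u z * f j z)"
        by (simp add: w2_def algebra_simps sum_subtractf sum_distrib_left)
      finally show ?thesis using u(2)[OF that] by simp
    qed
    with * show ?thesis by (intro exI[of _ Z'] exI[of _ w']) auto
  qed
qed

text \<open>Two combinations of evaluations that agree on every \<open>f j\<close> agree on
  \<open>V\<close>, so the reduction is carried out on the spanning functions, which may lie outside
  \<open>V\<close>. The bound is uniform in the functional.\<close>

lemma point_cone_few_nodes:
  fixes f :: "'j \<Rightarrow> 'a \<Rightarrow> real"
  assumes "\<Lambda> \<in> point_cone V R" "finite J"
    and V: "\<And>p. p \<in> V \<Longrightarrow> \<exists>c. \<forall>x. p x = (\<Sum>j\<in>J. c j * f j x)"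
  obtains n :: nat and w z where "n \<le> card J" "\<forall>i<n. 0 < w i \<and> z i \<in> R"
    "\<forall>p\<in>V. \<Lambda> p = (\<Sum>i<n. w i * p (z i))"
proof -
  obtain Z0 w0 where 0: "finite Z0" "Z0 \<subseteq> R" "\<forall>z\<in>Z0. 0 \<le> w0 z" "\<forall>p\<in>V. \<Lambda> p = (\<Sum>z\<in>Z0. w0 z * p z)"
    using assms(1) unfolding point_cone_def by blast
  obtain Z w where Z: "Z \<subseteq> Z0" "card Z \<le> card J" "\<forall>z\<in>Z. 0 < w z"
    "\<forall>j\<in>J. (\<Sum>z\<in>Z. w z * f j z) = (\<Sum>z\<in>Z0. w0 z * f j z)"
    using conic_caratheodory[OF \<open>finite J\<close> 0(1,3), of f] by blast
  have rep: "\<Lambda> p = (\<Sum>z\<in>Z. w z * p z)" if "p \<in> V" for p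
  proof -
    obtain c where c: "\<And>x. p x = (\<Sum>j\<in>J. c j * f j x)" using V[OF \<open>p \<in> V\<close>] by blast
    have "(\<Sum>z\<in>X. v z * p z) = (\<Sum>j\<in>J. c j * (\<Sum>z\<in>X. v z * f j z))" for X v
      unfolding c sum_distrib_left by (subst sum.swap) (simp add: mult_ac)
    with 0 Z that show ?thesis by simp
  qed
  have "finite Z" using 0 Z finite_subset by blast
  then obtain h where h: "bij_betw h {..<card Z} Z"
    using ex_bij_betw_nat_finite[of Z] by (auto simp: atLeast0LessThan)
  then have hZ: "h i \<in> Z" if "i < card Z" for i using that by (auto simp: bij_betw_def)
  show thesis
  proof (rule that[of "card Z" "w \<circ> h" h])
    show "\<forall>p\<in>V. \<Lambda> p = (\<Sum>i<card Z. (w \<circ> h) i * p (h i))"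
      using rep sum.reindex_bij_betw[OF h, of "\<lambda>z. w z * p z" for p] by simp
    show "\<forall>i<card Z. 0 < (w \<circ> h) i \<and> h i \<in> R"
      using Z(1,3) 0(2) hZ by auto
  qed (rule Z(2))
qed

section \<open>Compactness and the extremal problem\<close>

lemma compact_Pi_UNIV:
  fixes S :: "'b::topological_space set"
  assumes "compact S"
  shows "compact (UNIV \<rightarrow> S :: ('a \<Rightarrow> 'b) set)"
proof -
  have "compactin (product_topology (\<lambda>_. euclidean) UNIV) (PiE UNIV (\<lambda>_::'a. S))"
    using assms by (simp add: compactin_PiE)
  then show ?thesis
    by (simp add: euclidean_product_topology PiE_UNIV_domain)
qed

text \<open>The extremal problem in abstract form: \<open>L\<close> will be the cell average and
  \<open>B\<close> a fixed positive combination of edge averages. The value \<open>t0\<close> makes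
  the set of admissible multiples nonempty.\<close>

lemma point_cone_max_subtraction:
  fixes f :: "'j \<Rightarrow> 'a::topological_space \<Rightarrow> real" and L B :: "('a \<Rightarrow> real) \<Rightarrow> real"
  assumes R: "compact R" "R \<noteq> {}" and J: "finite J"
    and V: "\<And>p. p \<in> V \<Longrightarrow> \<exists>c. \<forall>x. p x = (\<Sum>j\<in>J. c j * f j x)"
    and cont: "\<And>p. p \<in> V \<Longrightarrow> continuous_on R p"
    and one: "(\<lambda>_. 1) \<in> V" "B (\<lambda>_. 1) > 0"
    and t0: "0 \<le> t0" "(\<lambda>p. L p - t0 * B p) \<in> point_cone V R"
  obtains t where "t0 \<le> t" "(\<lambda>p. L p - t * B p) \<in> point_cone V R"
    "\<forall>s\<ge>0. (\<lambda>p. L p - s * B p) \<in> point_cone V R \<longrightarrow> s \<le> t"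
proof -
  obtain r where r: "r \<in> R" using R by blast
  define N where "N = card J"
  \<comment> \<open>Weights and nodes are infinite sequences, of which \<open>F\<close> reads the
    first \<open>N\<close> terms; in the product topology Tychonoff's theorem makes
    \<open>K0\<close> compact.\<close>
  define K0 where "K0 = {0..L (\<lambda>_. 1) / B (\<lambda>_. 1)} \<times> (UNIV \<rightarrow> {0..L (\<lambda>_. 1)} :: (nat \<Rightarrow> real) set) \<times> (UNIV \<rightarrow> R :: (nat \<Rightarrow> 'a) set)"
  define F where "F p = (\<lambda>(t, w, z). t * B p + (\<Sum>i<N. w i * p (z i)))" for p :: "'a \<Rightarrow> real"
  \<comment> \<open>\<open>card J\<close> nodes suffice, and testing with the constant 1 bounds \<open>t\<close> and the weights; hence the
    admissible \<open>t\<close> form a projection of a compact set.\<close>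
  define K where "K = K0 \<inter> (\<Inter>p\<in>V. {x \<in> K0. F p x = L p})"
  have "compact K0"
    unfolding K0_def by (intro compact_Times compact_Pi_UNIV compact_Icc R)
  have "continuous_on K0 (F p)" if "p \<in> V" for p
  proof -
    have "continuous_on K0 (\<lambda>x. fst (snd x) i)" "continuous_on K0 (\<lambda>x. snd (snd x) i)" for i
      by (rule continuous_on_product_then_coordinatewise,
          intro continuous_on_fst continuous_on_snd continuous_on_id)+
    moreover from this(2) have "continuous_on K0 (\<lambda>x. p (snd (snd x) i))" for i
      by (rule continuous_on_compose2[OF cont[OF that]]) (auto simp: K0_def)
    ultimately show ?thesis
      unfolding F_def case_prod_beta
      by (intro continuous_on_add continuous_on_sum continuous_on_mult continuous_on_fst
          continuous_on_id continuous_on_const)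
  qed
  then have "closedin (top_of_set K0) {x \<in> K0. F p x = L p}" if "p \<in> V" for p
    using that continuous_closedin_preimage_constant by blast
  then have "closedin (top_of_set K0) (\<Inter>p\<in>V. {x \<in> K0. F p x = L p})"
    \<comment> \<open>The constant 1 also shows that the intersection is over a nonempty
      family.\<close>
    using one by (intro closedin_Inter) auto
  then have "closedin (top_of_set K0) K"
    unfolding K_def by (intro closedin_Int) auto
  then have "compact K"
    using \<open>compact K0\<close> closedin_compact by blast
  have in_K: "s \<in> fst ` K" if s: "0 \<le> s" "(\<lambda>p. L p - s * B p) \<in> point_cone V R" for s
  proof -
    obtain n :: nat and w z where n: "n \<le> N" "\<forall>i<n. 0 < w i \<and> z i \<in> R"
      and rep: "\<forall>p\<in>V. L p - s * B p = (\<Sum>i<n. w i * p (z i))"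
      unfolding N_def by (rule point_cone_few_nodes[OF s(2) J V])
    \<comment> \<open>Padding with zero weights at an arbitrary point \<open>r\<close> of
      \<open>R\<close>; the weights in \<open>K0\<close> are allowed to vanish for this
      reason.\<close>
    define w' where "w' i = (if i < n then w i else 0)" for i
    define z' where "z' i = (if i < n then z i else r)" for i
    have rep': "(\<Sum>i<N. w' i * p (z' i)) = L p - s * B p" if "p \<in> V" for p
      unfolding rep[rule_format, OF that] using n(1)
      by (intro sum.mono_neutral_cong_right) (auto simp: w'_def z'_def)
    have w': "0 \<le> w' i" for i using n(2) by (auto simp: w'_def intro: less_imp_le)
    have sum1: "(\<Sum>i<N. w' i) + s * B (\<lambda>_. 1) = L (\<lambda>_. 1)" using rep'[OF one(1)] by simp
    have sB: "0 \<le> s * B (\<lambda>_. 1)" using s one by simp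
    have "w' i \<le> L (\<lambda>_. 1)" for i
    proof (cases "i < N")
      case True
      then have "w' i \<le> (\<Sum>i<N. w' i)" using w' by (intro member_le_sum) auto
      then show ?thesis using sum1 sB by linarith
    next
      case False
      then have "w' i = 0" using n(1) by (simp add: w'_def)
      then show ?thesis using sum1 sB sum_nonneg[of "{..<N}" w'] w' by simp
    qed
    moreover have "s \<le> L (\<lambda>_. 1) / B (\<lambda>_. 1)"
      using sum1 sum_nonneg[of "{..<N}" w'] w' one by (simp add: pos_le_divide_eq)
    ultimately have "(s, w', z') \<in> K"
      using s w' n(2) r rep' by (auto simp: K_def K0_def F_def z'_def)
    then show ?thesis by force
  qed
  have "compact (fst ` K)"
    by (intro compact_continuous_image \<open>compact K\<close> continuous_intros)
  moreover have "fst ` K \<noteq> {}" using in_K[OF t0] by blast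
  ultimately obtain t where t: "t \<in> fst ` K" "\<And>s. s \<in> fst ` K \<Longrightarrow> s \<le> t"
    using compact_attains_sup by metis
  then obtain w z where K: "(t, w, z) \<in> K" by auto
  have "(\<lambda>p. \<Sum>i<N. w i * p (z i)) \<in> point_cone V R"
    by (intro point_cone_sum point_cone_scale point_cone_eval) (use K in \<open>auto simp: K_def K0_def\<close>)
  then have "(\<lambda>p. L p - t * B p) \<in> point_cone V R"
    by (rule point_cone_cong) (use K in \<open>auto simp: K_def F_def\<close>)
  then show thesis
    using that t in_K t0 by blast
qed

section \<open>Decompositions of the cell average\<close>

lemma partial_deg_polys_slice:
  assumes "p \<in> partial_deg_polys k"
  shows "\<exists>c. \<forall>x. p (x, y) = (\<Sum>m\<le>k. c m * x ^ m)"
    and "\<exists>c. \<forall>y. p (x, y) = (\<Sum>m\<le>k. c m * y ^ m)"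
proof -
  obtain c where "\<And>x y. p (x, y) = (\<Sum>(m, n) \<in> {..k} \<times> {..k}. c m n * x ^ m * y ^ n)"
    using assms unfolding partial_deg_polys_def by blast
  then have c: "p (x, y) = (\<Sum>m\<le>k. \<Sum>n\<le>k. c m n * x ^ m * y ^ n)" for x y
    by (simp only: sum.cartesian_product)
  show "\<exists>c. \<forall>x. p (x, y) = (\<Sum>m\<le>k. c m * x ^ m)"
  proof (intro exI allI)
    fix x
    show "p (x, y) = (\<Sum>m\<le>k. (\<Sum>n\<le>k. c m n * y ^ n) * x ^ m)"
      unfolding c sum_distrib_right by (intro sum.cong refl) simp
  qed
  show "\<exists>c. \<forall>y. p (x, y) = (\<Sum>m\<le>k. c m * y ^ m)"
  proof (intro exI allI)
    fix y
    show "p (x, y) = (\<Sum>n\<le>k. (\<Sum>m\<le>k. c m n * x ^ m) * y ^ n)"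
      unfolding c sum_distrib_right by (rule sum.swap)
  qed
qed

lemma partial_deg_polys_span:
  assumes "p \<in> partial_deg_polys k"
  obtains c where "\<And>z. p z = (\<Sum>j \<in> {..k} \<times> {..k}. c j * (fst z ^ fst j * snd z ^ snd j))"
proof -
  obtain c where c: "\<And>x y. p (x, y) = (\<Sum>(m, n) \<in> {..k} \<times> {..k}. c m n * x ^ m * y ^ n)"
    using assms unfolding partial_deg_polys_def by blast
  show thesis
  proof
    fix z
    show "p z = (\<Sum>j \<in> {..k} \<times> {..k}. c (fst j) (snd j) * (fst z ^ fst j * snd z ^ snd j))"
      using c[of "fst z" "snd z"] by (simp add: case_prod_beta mult.assoc)
  qed
qed

lemma continuous_on_partial_deg_polys:
  assumes "p \<in> partial_deg_polys k"
  shows "continuous_on S p"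
proof -
  obtain c where "\<And>z. p z = (\<Sum>j \<in> {..k} \<times> {..k}. c j * (fst z ^ fst j * snd z ^ snd j))"
    using partial_deg_polys_span[OF assms] by blast
  then have p: "p = (\<lambda>z. \<Sum>j \<in> {..k} \<times> {..k}. c j * (fst z ^ fst j * snd z ^ snd j))"
    by (rule ext)
  show ?thesis
    unfolding p
    by (intro continuous_on_sum continuous_on_mult continuous_on_power continuous_on_const
        continuous_on_fst continuous_on_snd continuous_on_id)
qed

lemma continuous_on_slices:
  assumes "p \<in> partial_deg_polys k"
  shows "continuous_on S (\<lambda>x. p (x, y))" "continuous_on S (\<lambda>y. p (x, y))"
  by (rule continuous_on_compose2[OF continuous_on_partial_deg_polys[OF assms, of UNIV]],
      intro continuous_on_Pair continuous_on_id continuous_on_const, simp)+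

section \<open>Edge averages and the cell average as functionals\<close>

definition hline :: "real \<Rightarrow> real \<Rightarrow> real \<Rightarrow> (real \<times> real \<Rightarrow> real) \<Rightarrow> real" where
  "hline xl xr y p = 1 / (xr - xl) * integral {xl..xr} (\<lambda>x. p (x, y))"

definition vline :: "real \<Rightarrow> real \<Rightarrow> real \<Rightarrow> (real \<times> real \<Rightarrow> real) \<Rightarrow> real" where
  "vline yl yr x p = 1 / (yr - yl) * integral {yl..yr} (\<lambda>y. p (x, y))"

definition cell_avg :: "real \<Rightarrow> real \<Rightarrow> real \<Rightarrow> real \<Rightarrow> (real \<times> real \<Rightarrow> real) \<Rightarrow> real" where
  "cell_avg xl xr yl yr p = 1 / ((xr - xl) * (yr - yl)) * integral ({xl..xr} \<times> {yl..yr}) p"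

lemma node_in_interval:
  fixes a b :: real
  assumes "a < b" "i \<le> n" "n > 0"
  shows "a + (b - a) * real i / real n \<in> {a..b}"
proof -
  have "(b - a) * (real i / real n) \<le> (b - a) * 1"
    using assms by (intro mult_left_mono) auto
  moreover have "0 \<le> (b - a) * (real i / real n)"
    using assms by simp
  ultimately show ?thesis by simp
qed

text \<open>Positive quadrature in \<open>y\<close> has all its nodes on the segment.\<close>

lemma vline_in_point_cone:
  assumes V: "V \<subseteq> partial_deg_polys k" and "yl < yr" "x \<in> {xl..xr}"
  shows "vline yl yr x \<in> point_cone V ({xl..xr} \<times> {yl..yr})"
proof -
  obtain n w where nw: "n > 0" "\<And>i. i \<le> n \<Longrightarrow> w i > 0"
    "\<And>f. \<exists>c. \<forall>x. f x = (\<Sum>m\<le>k. c m * x ^ m) \<Longrightarrow>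
       integral {yl..yr} f = (\<Sum>i\<le>n. w i * f (yl + (yr - yl) * real i / real n))"
    using positive_quadrature[OF \<open>yl < yr\<close>, of k] by blast
  have "(\<lambda>p. 1 / (yr - yl) * (\<Sum>i\<le>n. w i * p (x, yl + (yr - yl) * real i / real n)))
      \<in> point_cone V ({xl..xr} \<times> {yl..yr})"
    using assms nw(1,2)
    by (intro point_cone_sum point_cone_scale point_cone_eval)
       (auto intro: less_imp_le simp del: atLeastAtMost_iff intro!: node_in_interval)
  then show ?thesis
    by (rule point_cone_cong) (use V nw(3) partial_deg_polys_slice(2) in \<open>auto simp: vline_def\<close>)
qed

lemma cell_avg_fubini:
  assumes p: "p \<in> partial_deg_polys k" and "xl < xr" "yl < yr"
  shows "cell_avg xl xr yl yr p = 1 / (xr - xl) * integral {xl..xr} (\<lambda>x. vline yl yr x p)"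
    and "cell_avg xl xr yl yr p = 1 / (yr - yl) * integral {yl..yr} (\<lambda>y. hline xl xr y p)"
proof -
  have box: "{xl..xr} \<times> {yl..yr} = cbox (xl, yl) (xr, yr)"
    by (metis cbox_Pair_eq cbox_interval)
  have 1: "integral ({xl..xr} \<times> {yl..yr}) p = integral {xl..xr} (\<lambda>x. integral {yl..yr} (\<lambda>y. p (x, y)))"
    using integral_prod_continuous[OF continuous_on_partial_deg_polys[OF p], of xl yl xr yr]
    unfolding box by simp
  have 2: "integral {xl..xr} (\<lambda>x. integral {yl..yr} (\<lambda>y. p (x, y)))
      = integral {yl..yr} (\<lambda>y. integral {xl..xr} (\<lambda>x. p (x, y)))"
    using integral_swap_continuous[of xl yl xr yr "\<lambda>x y. p (x, y)"]
      continuous_on_partial_deg_polys[OF p] by simp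
  show "cell_avg xl xr yl yr p = 1 / (xr - xl) * integral {xl..xr} (\<lambda>x. vline yl yr x p)"
    unfolding cell_avg_def vline_def 1 by simp
  show "cell_avg xl xr yl yr p = 1 / (yr - yl) * integral {yl..yr} (\<lambda>y. hline xl xr y p)"
    unfolding cell_avg_def hline_def 1 2 by simp
qed

text \<open>Quadrature in \<open>x\<close> writes the cell average as a positive combination of
  averages over vertical segments. Both end points are nodes, so the two edges occur with positive
  weights, and \<open>e\<close> is the smaller of these.\<close>

lemma cell_avg_minus_vertical_edges:
  assumes V: "V \<subseteq> partial_deg_polys k" and ab: "xl < xr" "yl < yr"
  obtains e where "e > 0" "\<And>s t. s \<le> e \<Longrightarrow> t \<le> e \<Longrightarrow>
    (\<lambda>p. cell_avg xl xr yl yr p - (s * vline yl yr xl p + t * vline yl yr xr p))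
      \<in> point_cone V ({xl..xr} \<times> {yl..yr})"
proof -
  obtain n w where nw: "n > 0" "\<And>i. i \<le> n \<Longrightarrow> w i > 0"
    "\<And>f. \<exists>c. \<forall>x. f x = (\<Sum>m\<le>k. c m * x ^ m) \<Longrightarrow>
       integral {xl..xr} f = (\<Sum>i\<le>n. w i * f (xl + (xr - xl) * real i / real n))"
    using positive_quadrature[OF \<open>xl < xr\<close>, of k] by blast
  define x where "x i = xl + (xr - xl) * real i / real n" for i
  define v where "v i = w i / (xr - xl)" for i
  have x: "x 0 = xl" "x n = xr" "\<And>i. i \<le> n \<Longrightarrow> x i \<in> {xl..xr}"
    using node_in_interval[OF ab(1)] nw(1) by (auto simp: x_def)
  have avg: "cell_avg xl xr yl yr p = (\<Sum>i\<le>n. v i * vline yl yr (x i) p)" if "p \<in> V" for p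
  proof -
    have p: "p \<in> partial_deg_polys k" using V that by blast
    have "hline xl xr y p = (\<Sum>i\<le>n. v i * p (x i, y))" for y
      unfolding hline_def v_def x_def
      using nw(3)[OF partial_deg_polys_slice(1)[OF p], of y] by (simp add: sum_divide_distrib)
    then have "cell_avg xl xr yl yr p
        = 1 / (yr - yl) * integral {yl..yr} (\<lambda>y. \<Sum>i\<le>n. v i * p (x i, y))"
      using cell_avg_fubini(2)[OF p ab] by simp
    also have "\<dots> = 1 / (yr - yl) * (\<Sum>i\<le>n. v i * integral {yl..yr} (\<lambda>y. p (x i, y)))"
      by (subst integral_sum)
         (auto intro!: integrable_continuous_real continuous_intros continuous_on_slices[OF p])
    finally show ?thesis
      by (simp add: vline_def sum_divide_distrib)
  qed
  \<comment> \<open>Since \<open>n > 0\<close>, the indices of the two edges differ, and no weight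
    loses both \<open>s\<close> and \<open>t\<close>.\<close>
  define u where "u s t i = v i - (of_bool (i = 0) * s + of_bool (i = n) * t)" for s t i
  show thesis
  proof
    show "min (v 0) (v n) > 0" using nw ab by (auto simp: v_def)
    fix s t assume st: "s \<le> min (v 0) (v n)" "t \<le> min (v 0) (v n)"
    have u: "0 \<le> u s t i" if "i \<le> n" for i
      using st that nw(1) nw(2)[OF that] ab by (auto simp: u_def v_def of_bool_def)
    have "(\<lambda>p. \<Sum>i\<le>n. u s t i * vline yl yr (x i) p) \<in> point_cone V ({xl..xr} \<times> {yl..yr})"
      using u x by (intro point_cone_sum point_cone_scale vline_in_point_cone[OF V ab(2)]) auto
    then show "(\<lambda>p. cell_avg xl xr yl yr p - (s * vline yl yr xl p + t * vline yl yr xr p))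
        \<in> point_cone V ({xl..xr} \<times> {yl..yr})"
    proof (rule point_cone_cong)
      fix p assume "p \<in> V"
      have "(\<Sum>i\<le>n. u s t i * vline yl yr (x i) p)
        = (\<Sum>i\<le>n. v i * vline yl yr (x i) p) - ((\<Sum>i\<le>n. of_bool (i = 0) * (s * vline yl yr (x i) p))
            + (\<Sum>i\<le>n. of_bool (i = n) * (t * vline yl yr (x i) p)))"
        unfolding u_def by (simp add: algebra_simps sum.distrib sum_subtractf)
      also have "(\<Sum>i\<le>n. of_bool (i = 0) * (s * vline yl yr (x i) p)) = s * vline yl yr xl p"
        by (subst sum.remove[of _ 0]) (auto simp: x intro!: sum.neutral)
      also have "(\<Sum>i\<le>n. of_bool (i = n) * (t * vline yl yr (x i) p)) = t * vline yl yr xr p"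
        by (subst sum.remove[of _ n]) (auto simp: x intro!: sum.neutral)
      finally show "cell_avg xl xr yl yr p - (s * vline yl yr xl p + t * vline yl yr xr p)
          = (\<Sum>i\<le>n. u s t i * vline yl yr (x i) p)"
        using avg[OF \<open>p \<in> V\<close>] by simp
    qed
  qed
qed

section \<open>Horizontal edges by exchanging the coordinates\<close>

text \<open>The results on vertical edges hold for every subset of the polynomial space, hence for
  the swapped \<open>V\<close> on the transposed rectangle; \<open>point_cone_compose\<close>
  carries them back.\<close>

lemma partial_deg_polys_swap:
  assumes "V \<subseteq> partial_deg_polys k"
  shows "(\<lambda>p. p \<circ> prod.swap) ` V \<subseteq> partial_deg_polys k"
proof clarify
  fix p assume "p \<in> V"
  then obtain c where c: "\<And>x y. p (x, y) = (\<Sum>(m, n) \<in> {..k} \<times> {..k}. c m n * x ^ m * y ^ n)"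
    using assms unfolding partial_deg_polys_def by blast
  have "(p \<circ> prod.swap) (x, y) = (\<Sum>(m, n) \<in> {..k} \<times> {..k}. c n m * x ^ m * y ^ n)" for x y
    unfolding prod.swap_def o_def fst_conv snd_conv c sum.cartesian_product[symmetric]
    by (subst sum.swap) (intro sum.cong refl, simp)
  then show "p \<circ> prod.swap \<in> partial_deg_polys k"
    unfolding partial_deg_polys_def by (intro CollectI exI[of _ "\<lambda>m n. c n m"]) blast
qed

lemma hline_eq_vline_swap: "hline xl xr y p = vline xl xr y (p \<circ> prod.swap)"
  by (simp add: hline_def vline_def)

lemma cell_avg_swap:
  assumes p: "p \<in> partial_deg_polys k" and ab: "xl < xr" "yl < yr"
  shows "cell_avg yl yr xl xr (p \<circ> prod.swap) = cell_avg xl xr yl yr p"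
proof -
  have "p \<circ> prod.swap \<in> partial_deg_polys k"
    using partial_deg_polys_swap[of "{p}" k] p by simp
  then show ?thesis
    using cell_avg_fubini(1)[OF _ ab(2,1)] cell_avg_fubini(2)[OF p ab]
    by (simp add: hline_eq_vline_swap)
qed

lemma hline_in_point_cone:
  assumes V: "V \<subseteq> partial_deg_polys k" and "xl < xr" "y \<in> {yl..yr}"
  shows "hline xl xr y \<in> point_cone V ({xl..xr} \<times> {yl..yr})"
proof -
  have "(\<lambda>p. vline xl xr y (p \<circ> prod.swap)) \<in> point_cone V (prod.swap ` ({yl..yr} \<times> {xl..xr}))"
    by (intro point_cone_compose vline_in_point_cone[OF partial_deg_polys_swap[OF V]] assms(2,3))
  then show ?thesis
    by (simp add: product_swap flip: hline_eq_vline_swap)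
qed

lemma cell_avg_minus_horizontal_edges:
  assumes V: "V \<subseteq> partial_deg_polys k" and ab: "xl < xr" "yl < yr"
  obtains e where "e > 0" "\<And>s t. s \<le> e \<Longrightarrow> t \<le> e \<Longrightarrow>
    (\<lambda>p. cell_avg xl xr yl yr p - (s * hline xl xr yl p + t * hline xl xr yr p))
      \<in> point_cone V ({xl..xr} \<times> {yl..yr})"
proof -
  obtain e where e: "e > 0" "\<And>s t. s \<le> e \<Longrightarrow> t \<le> e \<Longrightarrow>
    (\<lambda>p. cell_avg yl yr xl xr p - (s * vline xl xr yl p + t * vline xl xr yr p))
      \<in> point_cone ((\<lambda>p. p \<circ> prod.swap) ` V) ({yl..yr} \<times> {xl..xr})"
    using cell_avg_minus_vertical_edges[OF partial_deg_polys_swap[OF V] ab(2,1)] by blast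
  show thesis
  proof (rule that[OF e(1)])
    fix s t assume "s \<le> e" "t \<le> e"
    from point_cone_compose[OF e(2)[OF this]]
    show "(\<lambda>p. cell_avg xl xr yl yr p - (s * hline xl xr yl p + t * hline xl xr yr p))
        \<in> point_cone V ({xl..xr} \<times> {yl..yr})"
      unfolding product_swap
      by (rule point_cone_cong) (use V cell_avg_swap[OF _ ab] in \<open>auto simp: hline_eq_vline_swap\<close>)
  qed
qed

text \<open>One half of the cell average pays for the vertical edges, the other half for the
  horizontal ones.\<close>

lemma cell_avg_minus_boundary:
  assumes V: "V \<subseteq> partial_deg_polys k" and ab: "xl < xr" "yl < yr" and c: "0 < c1" "0 < c2"
  obtains t where "0 < t" "(\<lambda>p. cell_avg xl xr yl yr p
      - t * (c1 * (vline yl yr xl p + vline yl yr xr p) + c2 * (hline xl xr yl p + hline xl xr yr p)))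
    \<in> point_cone V ({xl..xr} \<times> {yl..yr})"
proof -
  let ?R = "{xl..xr} \<times> {yl..yr}"
  obtain e1 where e1: "e1 > 0" "\<And>s t. s \<le> e1 \<Longrightarrow> t \<le> e1 \<Longrightarrow>
    (\<lambda>p. cell_avg xl xr yl yr p - (s * vline yl yr xl p + t * vline yl yr xr p)) \<in> point_cone V ?R"
    using cell_avg_minus_vertical_edges[OF V ab] by blast
  obtain e2 where e2: "e2 > 0" "\<And>s t. s \<le> e2 \<Longrightarrow> t \<le> e2 \<Longrightarrow>
    (\<lambda>p. cell_avg xl xr yl yr p - (s * hline xl xr yl p + t * hline xl xr yr p)) \<in> point_cone V ?R"
    using cell_avg_minus_horizontal_edges[OF V ab] by blast
  \<comment> \<open>The factor 2 compensates for halving the cell average.\<close>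
  define t where "t = min (e1 / (2 * c1)) (e2 / (2 * c2))"
  have "t \<le> e1 / (2 * c1)" "t \<le> e2 / (2 * c2)" by (auto simp: t_def)
  then have t: "2 * t * c1 \<le> e1" "2 * t * c2 \<le> e2"
    using c by (simp_all add: field_simps)
  have "0 < t" using c e1(1) e2(1) by (simp add: t_def)
  have "(\<lambda>p. 1 / 2 * (cell_avg xl xr yl yr p - (2 * t * c1 * vline yl yr xl p + 2 * t * c1 * vline yl yr xr p))
      + 1 / 2 * (cell_avg xl xr yl yr p - (2 * t * c2 * hline xl xr yl p + 2 * t * c2 * hline xl xr yr p)))
    \<in> point_cone V ?R"
    by (intro point_cone_add point_cone_scale e1(2) e2(2) t) auto
  then have "(\<lambda>p. cell_avg xl xr yl yr p
      - t * (c1 * (vline yl yr xl p + vline yl yr xr p) + c2 * (hline xl xr yl p + hline xl xr yr p)))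
    \<in> point_cone V ?R"
    by (rule point_cone_cong) (simp add: field_simps)
  with \<open>0 < t\<close> show thesis using that by blast
qed

section \<open>The balanced optimal decomposition\<close>

lemma feasible_cad_iff:
  assumes V: "V \<subseteq> partial_deg_polys k"
  shows "feasible_cad V xl xr yl yr C \<longleftrightarrow>
     w1m C > 0 \<and> w1p C > 0 \<and> w2m C > 0 \<and> w2p C > 0 \<and>
     (\<forall>s \<in> {1..num_nodes C}. int_weight C s > 0 \<and> int_node C s \<in> {xl..xr} \<times> {yl..yr}) \<and>
     (\<forall>p \<in> V. cell_avg xl xr yl yr p =
          w1m C * vline yl yr xl p + w1p C * vline yl yr xr p
        + (w2m C * hline xl xr yl p + w2p C * hline xl xr yr p)
        + (\<Sum>s = 1..num_nodes C. int_weight C s * p (int_node C s)))"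
proof -
  have edges: "1 / (yr - yl) * integral {yl..yr} (\<lambda>y. w1m C * p (xl, y) + w1p C * p (xr, y))
      = w1m C * vline yl yr xl p + w1p C * vline yl yr xr p"
    "1 / (xr - xl) * integral {xl..xr} (\<lambda>x. w2m C * p (x, yl) + w2p C * p (x, yr))
      = w2m C * hline xl xr yl p + w2p C * hline xl xr yr p" if "p \<in> V" for p
  proof -
    have p: "p \<in> partial_deg_polys k" using V that by blast
    show "1 / (yr - yl) * integral {yl..yr} (\<lambda>y. w1m C * p (xl, y) + w1p C * p (xr, y))
        = w1m C * vline yl yr xl p + w1p C * vline yl yr xr p"
      unfolding vline_def
      by (subst integral_add)
         (auto simp: add_divide_distrib intro!: integrable_continuous_real continuous_intros continuous_on_slices[OF p])
    show "1 / (xr - xl) * integral {xl..xr} (\<lambda>x. w2m C * p (x, yl) + w2p C * p (x, yr))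
        = w2m C * hline xl xr yl p + w2p C * hline xl xr yr p"
      unfolding hline_def
      by (subst integral_add)
         (auto simp: add_divide_distrib intro!: integrable_continuous_real continuous_intros continuous_on_slices[OF p])
  qed
  then show ?thesis
    unfolding feasible_cad_def cell_avg_def by (intro conj_cong ball_cong refl) (simp only: edges)
qed

text \<open>The products on the right are the boundary weights at which the corresponding term of
  the minimum equals \<open>g\<close>.\<close>

lemma G2_le_iff:
  assumes "a1 > 0" "a2 > 0" "dx > 0" "dy > 0"
  shows "g \<le> G2 a1 a2 dx dy v1 v2 v3 v4 \<longleftrightarrow>
    g * (a1 / dx) \<le> v1 \<and> g * (a1 / dx) \<le> v2 \<and> g * (a2 / dy) \<le> v3 \<and> g * (a2 / dy) \<le> v4"
proof -
  have "g \<le> v * d / a \<longleftrightarrow> g * (a / d) \<le> v" if "a > 0" "d > 0" for v d a :: real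
    using that by (simp add: field_simps)
  then show ?thesis
    unfolding G2_def using assms by simp
qed

lemma balanced_optimal_cad_exists:
  assumes V: "V \<subseteq> partial_deg_polys k" and one: "(\<lambda>_. 1) \<in> V"
    and a: "a1 > 0" "a2 > 0" and ab: "xl < xr" "yl < yr"
  obtains C t where "optimal_cad V a1 a2 xl xr yl yr C" "cad_G2 a1 a2 xl xr yl yr C = t"
    "w1m C = t * (a1 / (xr - xl))" "w1p C = t * (a1 / (xr - xl))"
    "w2m C = t * (a2 / (yr - yl))" "w2p C = t * (a2 / (yr - yl))"
proof -
  let ?R = "{xl..xr} \<times> {yl..yr}" and ?J = "{..k} \<times> {..k}"
  let ?f = "\<lambda>j z :: real \<times> real. fst z ^ fst j * snd z ^ snd j"
  \<comment> \<open>Boundary weights \<open>c1\<close> and \<open>c2\<close> make all four terms of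
    \<open>G2\<close> equal to 1, so \<open>t\<close> times these makes them equal to
    \<open>t\<close>.\<close>
  define c1 c2 where "c1 = a1 / (xr - xl)" and "c2 = a2 / (yr - yl)"
  have c: "c1 > 0" "c2 > 0" using a ab by (auto simp: c1_def c2_def)
  define L where "L = cell_avg xl xr yl yr"
  define B where "B p = c1 * (vline yl yr xl p + vline yl yr xr p)
      + c2 * (hline xl xr yl p + hline xl xr yr p)" for p
  obtain t0 where t0: "0 < t0" "(\<lambda>p. L p - t0 * B p) \<in> point_cone V ?R"
    unfolding L_def B_def by (rule cell_avg_minus_boundary[OF V ab c])
  have span: "\<exists>c. \<forall>z. p z = (\<Sum>j\<in>?J. c j * ?f j z)" if "p \<in> V" for p
    using partial_deg_polys_span[of p k] V that by blast
  have cont: "continuous_on ?R p" if "p \<in> V" for p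
    using continuous_on_partial_deg_polys V that by blast
  have R: "compact ?R" "?R \<noteq> {}"
    using ab by (auto intro!: compact_Times)
  have finite_J: "finite ?J" by simp
  have B1: "B (\<lambda>_. 1) > 0"
    using c ab by (simp add: B_def vline_def hline_def add_pos_pos)
  obtain t where t: "t0 \<le> t" "(\<lambda>p. L p - t * B p) \<in> point_cone V ?R"
    "\<forall>s\<ge>0. (\<lambda>p. L p - s * B p) \<in> point_cone V ?R \<longrightarrow> s \<le> t"
    by (rule point_cone_max_subtraction[where L = L and B = B,
          OF R finite_J span cont one B1 less_imp_le[OF t0(1)] t0(2)])
  \<comment> \<open>Feasibility demands strictly positive boundary weights.\<close>
  have "t > 0" using t t0 by linarith
  obtain n :: nat and w z where n: "\<forall>i<n. 0 < w i \<and> z i \<in> ?R"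
    "\<forall>p\<in>V. L p - t * B p = (\<Sum>i<n. w i * p (z i))"
    by (rule point_cone_few_nodes[OF t(2) finite_J span])
  \<comment> \<open>The shift by one is due to internal nodes being numbered from 1.\<close>
  define C where "C = \<lparr>w1m = t * c1, w1p = t * c1, w2m = t * c2, w2p = t * c2, num_nodes = n,
      int_weight = (\<lambda>s. w (s - 1)), int_node = (\<lambda>s. z (s - 1))\<rparr>"
  have feas: "feasible_cad V xl xr yl yr C"
    unfolding feasible_cad_iff[OF V]
  proof (intro conjI ballI)
    fix p assume "p \<in> V"
    have "(\<Sum>s = 1..num_nodes C. int_weight C s * p (int_node C s)) = (\<Sum>i<n. w i * p (z i))"
      by (simp add: C_def sum.atLeast1_atMost_eq)
    with n(2) \<open>p \<in> V\<close>
    show "cell_avg xl xr yl yr p =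
          w1m C * vline yl yr xl p + w1p C * vline yl yr xr p
        + (w2m C * hline xl xr yl p + w2p C * hline xl xr yr p)
        + (\<Sum>s = 1..num_nodes C. int_weight C s * p (int_node C s))"
      by (simp add: C_def L_def B_def algebra_simps)
  qed (use n(1) c \<open>t > 0\<close> in \<open>auto simp: C_def simp del: mem_Sigma_iff\<close>)
  have G2C: "cad_G2 a1 a2 xl xr yl yr C = t"
    using a ab by (simp add: cad_G2_def G2_def C_def c1_def c2_def)
  have "cad_G2 a1 a2 xl xr yl yr C' \<le> t" if "feasible_cad V xl xr yl yr C'" for C'
  proof -
    have pos: "0 < w1m C'" "0 < w1p C'" "0 < w2m C'" "0 < w2p C'"
      and nodes: "\<And>s. s \<in> {1..num_nodes C'} \<Longrightarrow> 0 < int_weight C' s \<and> int_node C' s \<in> ?R"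
      and id: "\<And>p. p \<in> V \<Longrightarrow> L p = w1m C' * vline yl yr xl p + w1p C' * vline yl yr xr p
          + (w2m C' * hline xl xr yl p + w2p C' * hline xl xr yr p)
          + (\<Sum>s = 1..num_nodes C'. int_weight C' s * p (int_node C' s))"
      using that unfolding feasible_cad_iff[OF V] L_def by blast+
    define g where "g = cad_G2 a1 a2 xl xr yl yr C'"
    have g: "g * c1 \<le> w1m C'" "g * c1 \<le> w1p C'" "g * c2 \<le> w2m C'" "g * c2 \<le> w2p C'"
      using G2_le_iff[of a1 a2 "xr - xl" "yr - yl" g "w1m C'" "w1p C'" "w2m C'" "w2p C'"] a ab
      by (simp_all add: g_def cad_G2_def c1_def c2_def)
    \<comment> \<open>The maximality of \<open>t\<close> is known only among nonnegative
      multiples.\<close>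
    have "0 \<le> g"
      using G2_le_iff[of a1 a2 "xr - xl" "yr - yl" 0 "w1m C'" "w1p C'" "w2m C'" "w2p C'"] a ab pos
      by (simp add: g_def cad_G2_def)
    moreover have "(\<lambda>p. L p - g * B p) \<in> point_cone V ?R"
    proof (rule point_cone_cong)
      \<comment> \<open>The excess of each boundary weight over the balanced one is nonnegative and
        multiplies an edge average, which lies in the cone.\<close>
      show "(\<lambda>p. (w1m C' - g * c1) * vline yl yr xl p + (w1p C' - g * c1) * vline yl yr xr p
          + ((w2m C' - g * c2) * hline xl xr yl p + (w2p C' - g * c2) * hline xl xr yr p)
          + (\<Sum>s = 1..num_nodes C'. int_weight C' s * p (int_node C' s))) \<in> point_cone V ?R"
        using g nodes ab
        by (intro point_cone_add point_cone_sum point_cone_scale point_cone_eval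
            vline_in_point_cone[OF V] hline_in_point_cone[OF V])
           (simp_all add: less_imp_le del: mem_Sigma_iff)
    next
      fix p assume "p \<in> V"
      show "L p - g * B p
          = (w1m C' - g * c1) * vline yl yr xl p + (w1p C' - g * c1) * vline yl yr xr p
          + ((w2m C' - g * c2) * hline xl xr yl p + (w2p C' - g * c2) * hline xl xr yr p)
          + (\<Sum>s = 1..num_nodes C'. int_weight C' s * p (int_node C' s))"
        unfolding id[OF \<open>p \<in> V\<close>] by (simp add: B_def algebra_simps)
    qed
    ultimately show ?thesis using t(3) by (simp add: g_def)
  qed
  with feas G2C have "optimal_cad V a1 a2 xl xr yl yr C"
    by (simp add: optimal_cad_def)
  then show thesis
    by (rule that[OF _ G2C]) (simp_all add: C_def c1_def c2_def)
qed

lemma max_G2_eq: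
  assumes "optimal_cad V a1 a2 xl xr yl yr C"
  shows "max_G2 V a1 a2 xl xr yl yr = cad_G2 a1 a2 xl xr yl yr C"
  unfolding max_G2_def using assms
  by (intro Greatest_equality) (auto simp: optimal_cad_def)

theorem theorem3p4:
  fixes k :: nat and V :: "(real \<times> real \<Rightarrow> real) set"
    and a1 a2 dx dy xl xr yl yr :: real
  assumes "k \<ge> 1"
    and "V = total_deg_polys k \<or> V = partial_deg_polys k"
    and "a1 > 0" "a2 > 0" "dx > 0" "dy > 0"
    and "dx = xr - xl" "dy = yr - yl"
  shows "(\<exists>C. optimal_cad V a1 a2 xl xr yl yr C) \<and>
    (\<exists>C. optimal_cad V a1 a2 xl xr yl yr C \<and>
      w1m C * dx / a1 = w1p C * dx / a1 \<and>
      w1p C * dx / a1 = w2m C * dy / a2 \<and>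
      w2m C * dy / a2 = w2p C * dy / a2 \<and>
      w2p C * dy / a2 = max_G2 V a1 a2 xl xr yl yr)"
proof -
  \<comment> \<open>Both choices of \<open>V\<close> are treated at once: only the inclusion and the
    constant 1 are used.\<close>
  have V: "V \<subseteq> partial_deg_polys k" "(\<lambda>_. 1) \<in> V"
    using assms(2) total_deg_subset_partial_deg one_in_total_deg_polys by blast+
  have "xl < xr" "yl < yr" using assms by auto
  from balanced_optimal_cad_exists[OF V \<open>a1 > 0\<close> \<open>a2 > 0\<close> this]
  obtain C t where C: "optimal_cad V a1 a2 xl xr yl yr C" "cad_G2 a1 a2 xl xr yl yr C = t"
    "w1m C = t * (a1 / dx)" "w1p C = t * (a1 / dx)" "w2m C = t * (a2 / dy)" "w2p C = t * (a2 / dy)"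
    unfolding assms(7,8) by metis
  then have "max_G2 V a1 a2 xl xr yl yr = t" by (simp add: max_G2_eq)
  moreover have "w1m C * dx / a1 = t" "w1p C * dx / a1 = t" "w2m C * dy / a2 = t" "w2p C * dy / a2 = t"
    using C assms(3-6) by auto
  ultimately show ?thesis using C(1) by metis
qed

end
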